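(* Let $n\ge 1$ and, for $j=1,2,\ldots,n$, let $A_j$ be a real symmetric matrix of size $m_j\times m_j$ with eigenpairs $(\lambda_{i,j},u_{i,j})$, $i=1,2,\ldots,m_j$, where for each $j$ the set $\{u_{1,j},u_{2,j},\ldots,u_{m_j,j}\}$ is orthonormal. Let $k\le \min\{m_1,m_2,\ldots,m_n\}$ and put $U_j=(u_{1,j}\,|\,u_{2,j}\,|\,\cdots\,|\,u_{k,j})$ (an $m_j\times k$ matrix), $j=1,\ldots,n$. Let $\rho_{i,j}$, $1\le i\ne j\le n$, be real numbers with $\rho_{i,j}=\rho_{j,i}$. Then the eigenvalues of the block matrix \[ C=\begin{pmatrix} A_1 & \rho_{1,2}U_1U_2^T & \cdots & \rho_{1,n}U_1U_n^T\\ \rho_{2,1}U_2U_1^T & A_2 & \cdots & \rho_{2,n}U_2U_n^T\\ \vdots & \vdots & \ddots & \vdots\\ \rho_{n,1}U_nU_1^T & \rho_{n,2}U_nU_2^T & \cdots & A_n \end{pmatrix} \] are $\lambda_{i,j}$ for $j=1,\ldots,n$ and $i=k+1,\ldots,m_j$, together with $\xi_{1,t},\xi_{2,t},\ldots,\xi_{n,t}$ for $t=1,\ldots,k$, where $\xi_{1,t},\ldots,\xi_{n,t}$ are the eigenvalues of the $n\times n$ matrix \[ C_t=\begin{pmatrix} \lambda_{t,1} & \rho_{1,2} & \cdots & \rho_{1,n}\\ \rho_{2,1} & \lambda_{t,2} & \cdots & \rho_{2,n}\\ \vdots & \vdots & \ddots & \vdots\\ \rho_{n,1} & \rho_{n,2}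 & \cdots & \lambda_{t,n} \end{pmatrix}. \]
   Context: An eigenpair $(\lambda,u)$ of a matrix $M$ means $Mu=\lambda u$ with $u\neq 0$. *)

theory Defs
  imports
    "Jordan_Normal_Form.Spectral_Radius"
    "HOL-Computational_Algebra.Fundamental_Theorem_Algebra"
    "HOL-Library.Multiset"
begin

text \<open>
  All eigenvalues of a real square matrix, with algebraic multiplicity. They are taken in the
  complex numbers so that no eigenvalue is lost before the matrix is known to be
  diagonalisable over the reals; an \<open>n \<times> n\<close> matrix thus has exactly \<open>n\<close> of them.
\<close>

definition eigvals_mset :: "real mat \<Rightarrow> complex multiset" where
  "eigvals_mset M = proots (char_poly (map_mat complex_of_real M))"

lemma char_poly_of_real_nonzero:
  assumes "M \<in> carrier_mat n n"
  shows "char_poly (map_mat complex_of_real M) \<noteq> 0"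
  using degree_monic_char_poly[of "map_mat complex_of_real M" n] assms by auto

lemma set_mset_eigvals_mset:
  assumes "M \<in> carrier_mat n n"
  shows "set_mset (eigvals_mset M) = spectrum (map_mat complex_of_real M)"
proof -
  have c: "map_mat complex_of_real M \<in> carrier_mat n n" using assms by simp
  show ?thesis
    unfolding eigvals_mset_def spectrum_def eigenvalue_root_char_poly[OF c]
    using char_poly_of_real_nonzero[OF assms] by simp
qed

lemma size_eigvals_mset:
  assumes "M \<in> carrier_mat n n"
  shows "size (eigvals_mset M) = n"
  using degree_monic_char_poly[of "map_mat complex_of_real M" n] assms
  by (simp add: eigvals_mset_def size_proots_complex)

text \<open>
  Block matrices with \<open>n \<times> n\<close> blocks, where block \<open>B i j\<close> has size \<open>m i \<times> m j\<close>.
  Blocks and entries are numbered from 0. Row \<open>block_offset m i\<close> is the first row of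
  the \<open>i\<close>-th block row, and \<open>block_index m r\<close> is the block row containing row \<open>r\<close>
  (likewise for columns).
\<close>

definition block_offset :: "(nat \<Rightarrow> nat) \<Rightarrow> nat \<Rightarrow> nat" where
  "block_offset m i = (\<Sum>l<i. m l)"

definition block_index :: "(nat \<Rightarrow> nat) \<Rightarrow> nat \<Rightarrow> nat" where
  "block_index m r = (LEAST i. r < block_offset m (Suc i))"

definition block_mat :: "nat \<Rightarrow> (nat \<Rightarrow> nat) \<Rightarrow> (nat \<Rightarrow> nat \<Rightarrow> 'a mat) \<Rightarrow> 'a mat" where
  "block_mat n m B = mat (block_offset m n) (block_offset m n) (\<lambda>(r, c).
     let i = block_index m r; j = block_index m c
     in B i j $$ (r - block_offset m i, c - block_offset m j))"

lemma block_offset_mono: "i \<le> j \<Longrightarrow> block_offset m i \<le> block_offset m j"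
  unfolding block_offset_def by (rule sum_mono2) auto

lemma block_index_offset:
  assumes "r < m i"
  shows "block_index m (block_offset m i + r) = i"
  unfolding block_index_def
proof (rule Least_equality)
  show "block_offset m i + r < block_offset m (Suc i)"
    using assms by (simp add: block_offset_def)
next
  fix l assume l: "block_offset m i + r < block_offset m (Suc l)"
  show "i \<le> l"
  proof (rule ccontr)
    assume "\<not> i \<le> l"
    then have "block_offset m (Suc l) \<le> block_offset m i"
      by (intro block_offset_mono) simp
    with l show False by simp
  qed
qed

lemma block_mat_carrier:
  "block_mat n m B \<in> carrier_mat (block_offset m n) (block_offset m n)"
  by (simp add: block_mat_def)

lemma block_mat_index:
  assumes "i < n" "j < n" "r < m i" "c < m j"
  shows "block_mat n m B $$ (block_offset m i + r, block_offset m j + c) = B i j $$ (r, c)"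
proof -
  have "block_offset m i + r < block_offset m n" if "i < n" "r < m i" for i r
  proof -
    have "block_offset m i + r < block_offset m (Suc i)"
      using that by (simp add: block_offset_def)
    also have "\<dots> \<le> block_offset m n"
      using that by (intro block_offset_mono) simp
    finally show ?thesis .
  qed
  then show ?thesis
    using assms by (simp add: block_mat_def block_index_offset)
qed

end

theory Submission
  imports Defs
begin

text \<open>
  The vectors \<open>u i j\<close>, each padded with zeros outside block \<open>j\<close>, form an orthonormal basis.
  For fixed \<open>t < k\<close> the span of the padded \<open>u t 0, \<dots>, u t (n - 1)\<close> is invariant under \<open>C\<close>, which
  acts on it by \<open>C\<^sub>t\<close>; each padded \<open>u i j\<close> with \<open>i \<ge> k\<close> is an eigenvector of \<open>C\<close> for
  \<open>lam i j\<close>. Listing the basis in this order, \<open>C\<close> becomes orthogonally similar to a block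
  diagonal matrix with diagonal blocks \<open>C\<^sub>0, \<dots>, C\<^sub>k\<^sub>-\<^sub>1\<close> followed by \<open>n\<close> diagonal matrices.
\<close>

section \<open>Block positions as coordinates for rows and columns\<close>

lemma block_offset_0 [simp]: "block_offset m 0 = 0"
  by (simp add: block_offset_def)

lemma block_offset_Suc [simp]: "block_offset m (Suc i) = block_offset m i + m i"
  by (simp add: block_offset_def)

lemma block_offset_less:
  assumes "i < n" "r < m i"
  shows "block_offset m i + r < block_offset m n"
proof -
  have "block_offset m i + r < block_offset m (Suc i)"
    using assms by simp
  also have "\<dots> \<le> block_offset m n"
    using assms by (intro block_offset_mono) simp
  finally show ?thesis .
qed

text \<open>Turns an arbitrary index into a pair (block, position), so that entrywise matrix
  identities can be checked with \<open>block_mat_index\<close>. A block of size 0 contributes no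
  pair.\<close>

lemma block_offset_cases:
  assumes "x < block_offset m n"
  obtains i r where "i < n" "r < m i" "x = block_offset m i + r"
proof -
  have "\<exists>i r. i < n \<and> r < m i \<and> x = block_offset m i + r"
    using assms
  proof (induction n)
    case (Suc n)
    show ?case
    proof (cases "x < block_offset m n")
      case True
      with Suc.IH show ?thesis using less_SucI by blast
    next
      case False
      with Suc.prems show ?thesis
        by (intro exI[of _ n] exI[of _ "x - block_offset m n"]) auto
    qed
  qed simp
  with that show ?thesis by blast
qed

text \<open>Splits the inner sum of a matrix product along the blocks, where the entries of a
  \<open>block_mat\<close> are known.\<close>

lemma sum_block_offset:
  "(\<Sum>x = 0..<block_offset m n. f x) = (\<Sum>i<n. \<Sum>r<m i. f (block_offset m i + r))"
proof (induction n)
  case (Suc n)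
  have "(\<Sum>x = 0..<block_offset m n + m n. f x)
      = (\<Sum>x = 0..<block_offset m n. f x) + (\<Sum>x = block_offset m n..<block_offset m n + m n. f x)"
    by (rule sum.atLeastLessThan_concat[symmetric]) auto
  also have "(\<Sum>x = block_offset m n..<block_offset m n + m n. f x) = (\<Sum>r<m n. f (block_offset m n + r))"
    using sum.shift_bounds_nat_ivl[of f 0 "block_offset m n" "m n"]
    by (simp add: add.commute lessThan_atLeast0)
  finally show ?case using Suc.IH by simp
qed simp

section \<open>Characteristic polynomials and eigenvalues of block diagonal matrices\<close>

lemma char_poly_four_block_diag:
  fixes A D :: "'a :: idom mat"
  assumes A: "A \<in> carrier_mat p p" and D: "D \<in> carrier_mat q q"
  shows "char_poly (four_block_mat A (0\<^sub>m p q) (0\<^sub>m q p) D) = char_poly A * char_poly D"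
proof -
  have "char_poly_matrix (four_block_mat A (0\<^sub>m p q) (0\<^sub>m q p) D)
      = four_block_mat (char_poly_matrix A) (0\<^sub>m p q) (0\<^sub>m q p) (char_poly_matrix D)"
    using A D by (intro eq_matI) (auto simp: char_poly_matrix_def)
  then show ?thesis
    unfolding char_poly_def
    using det_four_block_mat_lower_left_zero[of "char_poly_matrix A" p "0\<^sub>m p q" q "0\<^sub>m q p"
        "char_poly_matrix D"] A D by simp
qed

text \<open>By induction on the number of blocks: the first \<open>n\<close> blocks are grouped into
  one, which leaves the two-by-two block case. The empty matrix has determinant 1, the empty
  product.\<close>

lemma char_poly_block_diag:
  fixes B :: "nat \<Rightarrow> nat \<Rightarrow> 'a :: idom mat"
  assumes "\<And>i. i < n \<Longrightarrow> B i i \<in> carrier_mat (m i) (m i)"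
    and "\<And>i j. i < n \<Longrightarrow> j < n \<Longrightarrow> i \<noteq> j \<Longrightarrow> B i j = 0\<^sub>m (m i) (m j)"
  shows "char_poly (block_mat n m B) = (\<Prod>i<n. char_poly (B i i))"
  using assms
proof (induction n)
  case 0
  have "char_poly_matrix (block_mat 0 m B) \<in> carrier_mat 0 0"
    using block_mat_carrier[of 0 m B] by simp
  then show ?case by (simp add: char_poly_def)
next
  case (Suc n)
  let ?N = "block_offset m n"
  let ?F = "four_block_mat (block_mat n m B) (0\<^sub>m ?N (m n)) (0\<^sub>m (m n) ?N) (B n n)"
  have carr: "B n n \<in> carrier_mat (m n) (m n)" "block_mat n m B \<in> carrier_mat ?N ?N"
    using Suc.prems block_mat_carrier by auto
  have "block_mat (Suc n) m B = ?F"
  proof (rule eq_matI)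
    fix x y assume "x < dim_row ?F" "y < dim_col ?F"
    then have "x < block_offset m (Suc n)" "y < block_offset m (Suc n)"
      using carr by auto
    then obtain i r j c where x: "i < Suc n" "r < m i" "x = block_offset m i + r"
      and y: "j < Suc n" "c < m j" "y = block_offset m j + c"
      by (metis block_offset_cases)
    \<comment> \<open>The four combinations are the four quadrants of \<open>?F\<close>; by
      \<open>block_offset_less\<close>, the blocks before the last fill exactly the indices below
      \<open>?N\<close>.\<close>
    have "i < n \<or> i = n" "j < n \<or> j = n" using x y by auto
    then show "block_mat (Suc n) m B $$ (x, y) = ?F $$ (x, y)"
      using x y carr block_offset_less[of i n r m] block_offset_less[of j n c m] Suc.prems(2)
      by (auto simp: block_mat_index)
  qed (use carr block_mat_carrier[of "Suc n" m B] in auto)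
  then show ?case
    using Suc carr by (simp add: char_poly_four_block_diag)
qed

lemma proots_char_poly_diag:
  fixes d :: "nat \<Rightarrow> 'a :: field"
  shows "proots (char_poly (mat p p (\<lambda>(i, j). if i = j then d i else 0)))
    = image_mset d (mset_set {0..<p})"
proof -
  let ?D = "mat p p (\<lambda>(i, j). if i = j then d i else 0)"
  have "char_poly ?D = (\<Prod>a \<leftarrow> diag_mat ?D. [:- a, 1:])"
    by (rule char_poly_upper_triangular) auto
  also have "diag_mat ?D = map d [0..<p]"
    by (auto simp: diag_mat_def)
  also have "(\<Prod>a \<leftarrow> map d [0..<p]. [:- a, 1:]) = (\<Prod>i = 0..<p. [:- d i, 1:])"
    by (simp add: prod.list_conv_set_nth comp_def)
  finally show ?thesis
    by (simp add: proots_prod sum_unfold_sum_mset)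
qed

text \<open>The real factorisation is carried to the complex numbers by the coefficient embedding.
  Roots with multiplicity add up over the product because each factor, being a characteristic
  polynomial, is nonzero.\<close>

lemma eigvals_mset_block_diag:
  assumes "\<And>i. i < n \<Longrightarrow> B i i \<in> carrier_mat (m i) (m i)"
    and "\<And>i j. i < n \<Longrightarrow> j < n \<Longrightarrow> i \<noteq> j \<Longrightarrow> B i j = 0\<^sub>m (m i) (m j)"
  shows "eigvals_mset (block_mat n m B) = (\<Sum>i<n. eigvals_mset (B i i))"
proof -
  interpret map_poly_hom: map_poly_comm_ring_hom complex_of_real ..
  have "char_poly (map_mat complex_of_real (block_mat n m B))
      = map_poly complex_of_real (\<Prod>i<n. char_poly (B i i))"
    by (simp add: of_real_hom.char_poly_hom[OF block_mat_carrier] char_poly_block_diag assms)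
  also have "\<dots> = (\<Prod>i<n. map_poly complex_of_real (char_poly (B i i)))"
    by (rule map_poly_hom.hom_prod)
  also have "\<dots> = (\<Prod>i<n. char_poly (map_mat complex_of_real (B i i)))"
    by (intro prod.cong refl) (simp add: of_real_hom.char_poly_hom[OF assms(1)])
  finally have "eigvals_mset (block_mat n m B)
      = proots (\<Prod>i<n. char_poly (map_mat complex_of_real (B i i)))"
    by (simp add: eigvals_mset_def)
  also have "\<dots> = (\<Sum>i<n. eigvals_mset (B i i))"
    unfolding eigvals_mset_def
    by (rule proots_prod) (use char_poly_of_real_nonzero[OF assms(1)] in auto)
  finally show ?thesis .
qed

lemma eigvals_mset_diag:
  "eigvals_mset (mat p p (\<lambda>(i, j). if i = j then d i else 0))
    = {# complex_of_real (d i). i \<in># mset_set {0..<p} #}"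
proof -
  have "map_mat complex_of_real (mat p p (\<lambda>(i, j). if i = j then d i else 0))
      = mat p p (\<lambda>(i, j). if i = j then complex_of_real (d i) else 0)"
    by (rule eq_matI) auto
  then show ?thesis
    by (simp add: eigvals_mset_def proots_char_poly_diag)
qed

section \<open>Orthogonal similarity and products with orthonormal columns\<close>

lemma char_poly_orthogonal_conj:
  fixes M D W :: "'a :: field mat"
  assumes M: "M \<in> carrier_mat p p" and D: "D \<in> carrier_mat p p" and W: "W \<in> carrier_mat p p"
    and orth: "W\<^sup>T * W = 1\<^sub>m p" and conj: "M * W = W * D"
  shows "char_poly M = char_poly D"
proof (rule char_poly_similar, rule similar_matI)
  have WT: "W\<^sup>T \<in> carrier_mat p p" using W by simp
  show "{M, D, W, W\<^sup>T} \<subseteq> carrier_mat p p" using M D W by simp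
  \<comment> \<open>A left inverse of a square matrix is also a right inverse, so orthonormal
    columns suffice for a similarity.\<close>
  show WWT: "W * W\<^sup>T = 1\<^sub>m p" by (rule mat_mult_left_right_inverse[OF WT W orth])
  show "W\<^sup>T * W = 1\<^sub>m p" by (rule orth)
  have "W * D * W\<^sup>T = M * (W * W\<^sup>T)"
    using assoc_mult_mat[OF M W WT] conj by simp
  then show "M = W * D * W\<^sup>T" using WWT M by simp
qed

lemma smult_mat_mult_vec:
  fixes M :: "'a :: comm_ring_1 mat"
  assumes "M \<in> carrier_mat p q" "v \<in> carrier_vec q"
  shows "(c \<cdot>\<^sub>m M) *\<^sub>v v = c \<cdot>\<^sub>v (M *\<^sub>v v)"
  using assms by (intro eq_vecI) (auto simp: scalar_prod_def sum_distrib_left mult.assoc)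

text \<open>Entry \<open>i\<close> of the product is the inner product of \<open>u i\<close> and
  \<open>u a\<close>. This is why the off-diagonal blocks of \<open>C\<close> couple only the first
  \<open>k\<close> eigenvectors and annihilate the others.\<close>

lemma mat_of_cols_transpose_mult_orthonormal:
  fixes u :: "nat \<Rightarrow> 'a :: field vec"
  assumes "\<And>i. i < p \<Longrightarrow> u i \<in> carrier_vec p" and "k \<le> p" and "a < p"
    and "\<And>i i'. i < p \<Longrightarrow> i' < p \<Longrightarrow> u i \<bullet> u i' = (if i = i' then 1 else 0)"
  shows "(mat_of_cols p (map u [0..<k]))\<^sup>T *\<^sub>v u a = (if a < k then unit_vec k a else 0\<^sub>v k)"
proof (rule eq_vecI)
  fix i assume "i < dim_vec (if a < k then unit_vec k a else 0\<^sub>v k)"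
  then have i: "i < k" by (simp split: if_splits)
  then have "col (mat_of_cols p (map u [0..<k])) i = u i"
    using assms by (subst col_mat_of_cols) auto
  then show "((mat_of_cols p (map u [0..<k]))\<^sup>T *\<^sub>v u a) $ i
      = (if a < k then unit_vec k a else 0\<^sub>v k) $ i"
    using i assms by auto
qed auto

lemma sum_lessThan_add:
  fixes f :: "nat \<Rightarrow> 'a :: comm_monoid_add"
  shows "(\<Sum>i<k + n. f i) = (\<Sum>i<k. f i) + (\<Sum>j<n. f (k + j))"
  by (induction n) (simp_all add: add.assoc)

section \<open>The reordered orthonormal basis and the spectrum of \<open>C\<close>\<close>

theorem theorem2p1:
  fixes n k :: nat
    and m :: "nat \<Rightarrow> nat"
    and A U :: "nat \<Rightarrow> real mat"
    and lam :: "nat \<Rightarrow> nat \<Rightarrow> real"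
    and u :: "nat \<Rightarrow> nat \<Rightarrow> real vec"
    and \<rho> :: "nat \<Rightarrow> nat \<Rightarrow> real"
    and C :: "real mat"
    and Ct :: "nat \<Rightarrow> real mat"
    and \<xi> :: "nat \<Rightarrow> nat \<Rightarrow> complex"
  assumes "n \<ge> 1"
    and "\<And>j. j < n \<Longrightarrow> A j \<in> carrier_mat (m j) (m j)"
    and "\<And>j. j < n \<Longrightarrow> (A j)\<^sup>T = A j"
    and "\<And>i j. j < n \<Longrightarrow> i < m j \<Longrightarrow> eigenvector (A j) (u i j) (lam i j)"
    and "\<And>i i' j. j < n \<Longrightarrow> i < m j \<Longrightarrow> i' < m j \<Longrightarrow>
           u i j \<bullet> u i' j = (if i = i' then 1 else 0)"
    and "\<And>j. j < n \<Longrightarrow> k \<le> m j"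
    and "\<And>j. j < n \<Longrightarrow> U j = mat_of_cols (m j) (map (\<lambda>i. u i j) [0..<k])"
    and "\<And>i j. i < n \<Longrightarrow> j < n \<Longrightarrow> i \<noteq> j \<Longrightarrow> \<rho> i j = \<rho> j i"
    and "C = block_mat n m (\<lambda>i j. if i = j then A i else \<rho> i j \<cdot>\<^sub>m (U i * (U j)\<^sup>T))"
    and "\<And>t. t < k \<Longrightarrow> Ct t = mat n n (\<lambda>(i, j). if i = j then lam t i else \<rho> i j)"
    and "\<And>t. t < k \<Longrightarrow> {# \<xi> s t. s \<in># mset_set {0..<n} #} = eigvals_mset (Ct t)"
  shows "eigvals_mset C =
           (\<Sum>j = 0..<n. {# complex_of_real (lam i j). i \<in># mset_set {k..<m j} #}) +
           (\<Sum>t = 0..<k. {# \<xi> s t. s \<in># mset_set {0..<n} #})"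
proof -
  note A = assms(2) and eig = assms(4) and orth = assms(5) and km = assms(6) and U = assms(7)
    and C = assms(9) and Ct = assms(10) and xi = assms(11)
  define N where "N = block_offset m n"
  define B where "B = (\<lambda>i j. if i = j then A i else \<rho> i j \<cdot>\<^sub>m (U i * (U j)\<^sup>T))"
  \<comment> \<open>Block \<open>s < k\<close> collects the \<open>s\<close>-th eigenvectors of all
    \<open>n\<close> matrices; block \<open>k + j\<close> collects those of \<open>A j\<close> from
    number \<open>k\<close> on.\<close>
  define m' where "m' s = (if s < k then n else m (s - k) - k)" for s
  \<comment> \<open>Column \<open>b\<close> of block \<open>s\<close> in the new order belongs to \<open>u (aa s b) (jj s b)\<close>.\<close>
  define jj where "jj s b = (if s < k then b else s - k)" for s b
  define aa where "aa s b = (if s < k then s else k + b)" for s b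
  define E where "E s t = (if s \<noteq> t then 0\<^sub>m (m' s) (m' t) else if s < k then Ct s
    else mat (m' s) (m' s) (\<lambda>(i, j). if i = j then lam (k + i) (s - k) else 0))" for s t
  define D where "D = block_mat (k + n) m' E"
  define W where "W = mat N N (\<lambda>(x, y). let i = block_index m x; s = block_index m' y;
    b = y - block_offset m' s in
    if i = jj s b then u (aa s b) i $ (x - block_offset m i) else 0)"

  \<comment> \<open>Each block \<open>j\<close> gives up \<open>k\<close> vectors to the first
    \<open>k\<close> new blocks. As \<open>k\<close> is at most \<open>m j\<close>, the truncated
    subtraction loses nothing, so \<open>W\<close> can be square.\<close>
  have N': "block_offset m' (k + n) = N"
  proof -
    have "block_offset m' (k + n) = k * n + (\<Sum>j<n. m j - k)"
      by (simp add: block_offset_def sum_lessThan_add m'_def)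
    also have "\<dots> = (\<Sum>j<n. k + (m j - k))"
      by (simp add: sum.distrib)
    also have "\<dots> = N"
      unfolding N_def block_offset_def using km by (intro sum.cong) auto
    finally show ?thesis .
  qed
  have uc: "u i j \<in> carrier_vec (m j)" if "j < n" "i < m j" for i j
    using eig[OF that] A[OF that(1)] by (auto simp: eigenvector_def)
  have jj: "jj s b < n" and aa: "aa s b < m (jj s b)" if "s < k + n" "b < m' s" for s b
    using that km[of b] by (auto simp: jj_def aa_def m'_def split: if_splits)
  \<comment> \<open>\<open>aa s b < k\<close> holds exactly when \<open>s < k\<close>, so the two
    kinds of label are disjoint; within each kind \<open>s\<close> and \<open>b\<close> can be read
    off.\<close>
  have label_inj: "jj s b = jj t c \<and> aa s b = aa t c \<longleftrightarrow> s = t \<and> b = c"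
    if "s < k + n" "b < m' s" "t < k + n" "c < m' t" for s b t c
    using that by (auto simp: jj_def aa_def split: if_splits)
  have Bc: "B i j \<in> carrier_mat (m i) (m j)" if "i < n" "j < n" for i j
    using that A U by (auto simp: B_def)
  have Ec: "E s t \<in> carrier_mat (m' s) (m' t)" if "s < k + n" "t < k + n" for s t
    using that Ct by (auto simp: E_def m'_def)
  have W: "W \<in> carrier_mat N N" by (simp add: W_def)
  have D: "D \<in> carrier_mat N N" unfolding D_def N'[symmetric] by (rule block_mat_carrier)
  have CB: "C = block_mat n m B" unfolding C B_def ..
  have Cc: "C \<in> carrier_mat N N" unfolding CB N_def by (rule block_mat_carrier)

  have W_index: "W $$ (block_offset m i + r, block_offset m' s + b)
      = (if i = jj s b then u (aa s b) i $ r else 0)"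
    if "i < n" "r < m i" "s < k + n" "b < m' s" for i r s b
    using that block_offset_less[of i n r m] block_offset_less[of s "k + n" b m']
    by (simp add: W_def N'[symmetric] N_def[symmetric] block_index_offset)

  \<comment> \<open>A column of \<open>W\<close> is supported in a single block of rows, so only
    that block survives in the sum.\<close>
  have sum_W: "(\<Sum>x = 0..<N. g x * W $$ (x, block_offset m' s + b))
      = (\<Sum>r<m (jj s b). g (block_offset m (jj s b) + r) * u (aa s b) (jj s b) $ r)"
    if "s < k + n" "b < m' s" for g :: "nat \<Rightarrow> real" and s b
  proof -
    have "(\<Sum>x = 0..<N. g x * W $$ (x, block_offset m' s + b))
      = (\<Sum>i<n. if i = jj s b then \<Sum>r<m i. g (block_offset m i + r) * u (aa s b) i $ r else 0)"
      unfolding N_def sum_block_offset using that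
      by (intro sum.cong refl) (auto simp: W_index)
    then show ?thesis using jj[OF that] by simp
  qed

  have "W\<^sup>T * W = 1\<^sub>m N"
  proof (rule eq_matI)
    fix x y assume "x < dim_row (1\<^sub>m N)" "y < dim_col (1\<^sub>m N)"
    then have xy: "x < block_offset m' (k + n)" "y < block_offset m' (k + n)" by (simp_all add: N')
    obtain s b where x: "s < k + n" "b < m' s" "x = block_offset m' s + b"
      using block_offset_cases[OF xy(1)] .
    obtain t c where y: "t < k + n" "c < m' t" "y = block_offset m' t + c"
      using block_offset_cases[OF xy(2)] .
    let ?j = "jj t c"
    have xy_eq: "x = y \<longleftrightarrow> s = t \<and> b = c"
      using x y block_index_offset[of b m' s] block_index_offset[of c m' t] by auto
    have "(W\<^sup>T * W) $$ (x, y) = (\<Sum>z = 0..<N. W $$ (z, x) * W $$ (z, y))"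
      using W xy N' by (simp add: scalar_prod_def)
    also have "\<dots> = (\<Sum>r<m ?j. W $$ (block_offset m ?j + r, x) * u (aa t c) ?j $ r)"
      unfolding y(3) by (rule sum_W[OF y(1,2)])
    \<comment> \<open>Columns living in different blocks have disjoint supports; within one block
      the orthonormality of the \<open>u i j\<close> decides.\<close>
    also have "\<dots> = (if jj s b = ?j then u (aa s b) ?j \<bullet> u (aa t c) ?j else 0)"
      unfolding scalar_prod_def carrier_vecD[OF uc[OF jj[OF y(1,2)] aa[OF y(1,2)]]]
      using W_index[OF jj[OF y(1,2)] _ x(1,2)] x(3) by (auto simp: lessThan_atLeast0 intro!: sum.cong)
    also have "\<dots> = (if jj s b = ?j \<and> aa s b = aa t c then 1 else 0)"
    proof (cases "jj s b = ?j")
      case True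
      then have "aa s b < m ?j" using aa[OF x(1,2)] by metis
      from orth[OF jj[OF y(1,2)] this aa[OF y(1,2)]] True show ?thesis by presburger
    qed simp
    also have "\<dots> = 1\<^sub>m N $$ (x, y)"
      unfolding label_inj[OF x(1,2) y(1,2)] xy_eq[symmetric] using xy N' by simp
    finally show "(W\<^sup>T * W) $$ (x, y) = 1\<^sub>m N $$ (x, y)" .
  qed (use W in auto)

  moreover have "C * W = W * D"
  proof (rule eq_matI)
    fix x y assume "x < dim_row (W * D)" "y < dim_col (W * D)"
    then have xy: "x < N" "y < N" using W D by auto
    obtain i r where x: "i < n" "r < m i" "x = block_offset m i + r"
      using block_offset_cases[OF xy(1)[unfolded N_def]] .
    obtain s b where y: "s < k + n" "b < m' s" "y = block_offset m' s + b"
      using block_offset_cases[OF xy(2)[folded N']] .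
    define j a where "j = jj s b" and "a = aa s b"
    have j: "j < n" and a: "a < m j" using jj[OF y(1,2)] aa[OF y(1,2)] by (auto simp: j_def a_def)
    have "(C * W) $$ (x, y) = (\<Sum>z = 0..<N. C $$ (x, z) * W $$ (z, y))"
      using W Cc xy by (simp add: scalar_prod_def)
    also have "\<dots> = (\<Sum>c<m j. C $$ (x, block_offset m j + c) * u a j $ c)"
      unfolding y(3) j_def a_def by (rule sum_W[OF y(1,2)])
    also have "\<dots> = (\<Sum>c<m j. B i j $$ (r, c) * u a j $ c)"
      using x j by (intro sum.cong) (auto simp: CB block_mat_index)
    also have "\<dots> = (B i j *\<^sub>v u a j) $ r"
      using Bc[OF x(1) j] x uc[OF j a] by (simp add: scalar_prod_def lessThan_atLeast0)
    \<comment> \<open>The diagonal block acts by the eigenvector equation. Off the diagonal,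
      \<open>(U j)\<^sup>T\<close> sends \<open>u a j\<close> to a unit vector or to zero, and
      \<open>U i\<close> sends that unit vector to its column \<open>u a i\<close>.\<close>
    also have "\<dots> = (if i = j then lam a j * u a j $ r
        else if a < k then \<rho> i j * u a i $ r else 0)"
    proof (cases "i = j")
      case True
      then show ?thesis
        using eig[OF j a] uc[OF j a] x by (simp add: B_def eigenvector_def)
    next
      case False
      have Uc: "U i \<in> carrier_mat (m i) k" "(U j)\<^sup>T \<in> carrier_mat k (m j)"
        using U x(1) j by auto
      have row0: "row (U i) r \<bullet> 0\<^sub>v k = 0" by (simp add: scalar_prod_def)
      have "B i j *\<^sub>v u a j = \<rho> i j \<cdot>\<^sub>v (U i *\<^sub>v ((U j)\<^sup>T *\<^sub>v u a j))"
        using False Uc uc[OF j a] assoc_mult_mat_vec[OF Uc uc[OF j a]]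
        by (simp add: B_def smult_mat_mult_vec[of _ "m i" "m j"])
      also have "(U j)\<^sup>T *\<^sub>v u a j = (if a < k then unit_vec k a else 0\<^sub>v k)"
        unfolding U[OF j]
        by (rule mat_of_cols_transpose_mult_orthonormal) (use uc[OF j] km[OF j] a orth[OF j] in auto)
      finally show ?thesis
        using row0 False U[OF x(1)] x(2) by (simp add: mat_of_cols_index)
    qed
    \<comment> \<open>For \<open>s < k\<close>, column \<open>c\<close> of block \<open>s\<close>
      lives in row block \<open>c\<close>, so only \<open>c = i\<close> contributes. Otherwise all
      columns of the block live in row block \<open>s - k\<close>, and the diagonal
      \<open>E s s\<close> keeps only \<open>c = b\<close>.\<close>
    also have "\<dots> = (\<Sum>c<m' s. (if i = jj s c then u (aa s c) i $ r else 0) * E s s $$ (c, b))"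
    proof (cases "s < k")
      case True
      have "(\<Sum>c<m' s. (if i = jj s c then u (aa s c) i $ r else 0) * E s s $$ (c, b))
          = (\<Sum>c<n. if i = c then u s i $ r * Ct s $$ (i, b) else 0)"
        using True by (intro sum.cong) (auto simp: m'_def jj_def aa_def E_def)
      also have "\<dots> = u s i $ r * (if i = b then lam s i else \<rho> i b)"
        using x(1) Ct[OF True] y(2) True by (simp add: m'_def)
      finally show ?thesis using True by (simp add: j_def a_def jj_def aa_def mult.commute)
    next
      case False
      have "(\<Sum>c<m' s. (if i = jj s c then u (aa s c) i $ r else 0) * E s s $$ (c, b))
          = (\<Sum>c<m' s. if c = b then (if i = s - k then u (k + b) i $ r * lam (k + b) (s - k) else 0)
              else 0)"
        using False y(2) by (intro sum.cong) (auto simp: jj_def aa_def E_def)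
      also have "\<dots> = (if i = s - k then u (k + b) i $ r * lam (k + b) (s - k) else 0)"
        using y(2) by simp
      finally show ?thesis using False by (simp add: j_def a_def jj_def aa_def mult.commute)
    qed
    also have "\<dots> = (\<Sum>c<m' s. W $$ (x, block_offset m' s + c) * E s s $$ (c, b))"
      using x y by (intro sum.cong) (auto simp: W_index)
    \<comment> \<open>The terms with \<open>t\<close> different from \<open>s\<close> are inserted
      as zeros, to match the vanishing blocks \<open>E t s\<close> in column \<open>y\<close> of
      \<open>D\<close>.\<close>
    also have "\<dots> = (\<Sum>t<k + n. if t = s then \<Sum>c<m' t. W $$ (x, block_offset m' t + c) * E t s $$ (c, b)
        else 0)"
      using y(1) by simp
    also have "\<dots> = (\<Sum>t<k + n. \<Sum>c<m' t. W $$ (x, block_offset m' t + c) * D $$ (block_offset m' t + c, y))"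
      using y by (intro sum.cong refl) (auto simp: D_def block_mat_index, auto simp: E_def)
    also have "\<dots> = (\<Sum>z = 0..<N. W $$ (x, z) * D $$ (z, y))"
      unfolding N'[symmetric] sum_block_offset ..
    also have "\<dots> = (W * D) $$ (x, y)"
      using W D xy by (simp add: scalar_prod_def)
    finally show "(C * W) $$ (x, y) = (W * D) $$ (x, y)" .
  qed (use W D Cc in auto)

  ultimately have "char_poly C = char_poly D"
    using char_poly_orthogonal_conj[OF Cc D W] by blast
  then have "eigvals_mset C = eigvals_mset D"
    by (simp add: eigvals_mset_def of_real_hom.char_poly_hom[OF Cc] of_real_hom.char_poly_hom[OF D])
  also have "\<dots> = (\<Sum>s<k + n. eigvals_mset (E s s))"
    unfolding D_def by (rule eigvals_mset_block_diag) (use Ec in blast, simp add: E_def)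
  also have "\<dots> = (\<Sum>t<k. eigvals_mset (Ct t))
      + (\<Sum>j<n. {# complex_of_real (lam (k + i) j). i \<in># mset_set {0..<m j - k} #})"
    unfolding sum_lessThan_add by (simp add: E_def eigvals_mset_diag m'_def)
  also have "(\<Sum>t<k. eigvals_mset (Ct t)) = (\<Sum>t = 0..<k. {# \<xi> s t. s \<in># mset_set {0..<n} #})"
    using xi by (simp add: lessThan_atLeast0)
  also have "(\<Sum>j<n. {# complex_of_real (lam (k + i) j). i \<in># mset_set {0..<m j - k} #})
      = (\<Sum>j = 0..<n. {# complex_of_real (lam i j). i \<in># mset_set {k..<m j} #})"
    unfolding lessThan_atLeast0
  proof (intro sum.cong refl)
    fix j assume "j \<in> {0..<n}"
    \<comment> \<open>The diagonal blocks count their entries from 0, whereas the remaining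
      eigenvalues are numbered from \<open>k\<close>; the shift is a bijection of the two index
      ranges.\<close>
    then have "mset_set {k..<m j} = image_mset ((+) k) (mset_set {0..<m j - k})"
      using km[of j] by (simp add: image_mset_mset_set image_add_atLeastLessThan)
    then show "{# complex_of_real (lam (k + i) j). i \<in># mset_set {0..<m j - k} #}
        = {# complex_of_real (lam i j). i \<in># mset_set {k..<m j} #}"
      by (simp add: multiset.map_comp comp_def)
  qed
  finally show ?thesis by (simp add: add.commute)
qed

end
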